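(* Let $r\in\mathbb{N}$, $n\in\mathbb{Z}_+$, $x\in\mathbb{Z}_p$ and $d\in\mathbb{N}$ with $d\equiv 1\pmod 2$. For $(q',w')\in\{(q,w),(q^d,w^d)\}$ and $y\in\mathbb{Z}_p$ let $$E_{n,w',q'}^{(r-1,r)}(y)=\int_{\mathbb{Z}_p^r} w'^{\,x_1+\cdots+x_r}[y+x_1+\cdots+x_r]_{q'}^n\,q'^{\sum_{i=1}^{r}(r-i)x_i}\,d\mu_{-1}(x_1)\cdots d\mu_{-1}(x_r).$$ Then $$E_{n,w,q}^{(r-1,r)}(x)=[d]_q^n\sum_{a_1,\dots,a_r=0}^{d-1}q^{\sum_{i=1}^{r}(r-i)a_i}(-1)^{a_1+\cdots+a_r}w^{a_1+\cdots+a_r}E_{n,w^d,q^d}^{(r-1,r)}\Big(\frac{a_1+\cdots+a_r+x}{d}\Big).$$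
   Context: Let $p$ be a fixed odd prime, $\mathbb{Z}_p$ the ring of $p$-adic integers, $\mathbb{C}_p$ the completion of the algebraic closure of $\mathbb{Q}_p$, and $\mathbb{Z}_+=\mathbb{N}\cup\{0\}$. Let $q,w\in\mathbb{C}_p$ with $|1-q|_p<1$ and $|1-w|_p<1$. For $x\in\mathbb{Z}_p$ put $[x]_q=\frac{1-q^x}{1-q}$. For a uniformly differentiable function $f:\mathbb{Z}_p\to\mathbb{C}_p$, the fermionic $p$-adic integral is $\int_{\mathbb{Z}_p}f(x)\,d\mu_{-1}(x)=\lim_{N\to\infty}\sum_{x=0}^{p^N-1}f(x)(-1)^x$, and $\int_{\mathbb{Z}_p^r}$ denotes the $r$-fold iterated fermionic integral.
   Formalization: The formal version assumes that every (a_1+…+a_r+x)/d lies in Z_p (for d>1: p does not divide d), since E(y) is defined only for y in Z_p and the right-hand side is otherwise undefined; at q=1 the convention [z]_1=z is used. *)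

theory Defs
  imports Complex_Main "HOL-Analysis.Elementary_Metric_Spaces" "HOL-Computational_Algebra.Polynomial"
    "HOL-Computational_Algebra.Primes" "HOL-Library.FuncSet" "HOL-Number_Theory.Cong"
begin

text \<open>
  The library has no \<open>p\<close>-adic numbers.  Since \<open>p\<close> is a variable, the field \<open>\<complex>\<^sub>p\<close> is given by a type
  variable of the class below (a complete field with a non-archimedean absolute value inducing its
  metric) subject to the predicate \<open>is_Cp p\<close>, which says that the type is the completion of an
  algebraic closure of the completion of the rationals under the \<open>p\<close>-adic absolute value.
\<close>

class complete_ultrametric_field = field_char_0 + complete_space +
  fixes vabs :: "'a \<Rightarrow> real"
  assumes dist_vabs: "dist x y = vabs (x - y)"
    and vabs_mult: "vabs (x * y) = vabs x * vabs y"
    and vabs_add_le_max: "vabs (x + y) \<le> max (vabs x) (vabs y)"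

text \<open>In a complete field, the completions of \<open>\<rat>\<close> and \<open>\<int>\<close> are their topological closures.\<close>

definition Qp :: "'a::complete_ultrametric_field set" where
  "Qp = closure \<rat>"

definition Zp :: "'a::complete_ultrametric_field set" where
  "Zp = closure \<int>"

definition Qp_bar :: "'a::complete_ultrametric_field set" where
  "Qp_bar = {z. \<exists>P. P \<noteq> 0 \<and> (\<forall>i. coeff P i \<in> Qp) \<and> poly P z = 0}"

text \<open>
  For a multiplicative non-archimedean absolute value, \<open>|p| = 1/p\<close> already forces it to be the
  normalised \<open>p\<close>-adic one on \<open>\<rat>\<close>.  The third conjunct makes \<open>Qp_bar\<close>, which is algebraic over
  \<open>Qp\<close> by definition, an algebraic closure of \<open>Qp\<close>.
\<close>

definition is_Cp :: "nat \<Rightarrow> 'a::complete_ultrametric_field itself \<Rightarrow> bool" where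
  "is_Cp p T \<longleftrightarrow>
     prime p \<and>
     vabs (of_nat p :: 'a) = 1 / real p \<and>
     (\<forall>P :: 'a poly. (\<forall>i. coeff P i \<in> Qp_bar) \<longrightarrow> degree P > 0 \<longrightarrow> (\<exists>z\<in>Qp_bar. poly P z = 0)) \<and>
     closure (Qp_bar :: 'a set) = UNIV"

text \<open>
  \<open>q\<^sup>z\<close> for \<open>z \<in> \<int>\<^sub>p\<close> and \<open>|1 - q| < 1\<close>, by the binomial series; this is the continuous
  interpolation of the ordinary powers \<open>q\<^sup>n\<close>.
\<close>

definition padic_pow :: "'a::complete_ultrametric_field \<Rightarrow> 'a \<Rightarrow> 'a" where
  "padic_pow q z = (\<Sum>k. (z gchoose k) * (q - 1) ^ k)"

text \<open>At \<open>q = 1\<close>, where the quotient is \<open>0/0\<close>, the usual convention \<open>[z]\<^sub>1 = lim\<^sub>q\<^sub>\<rightarrow>\<^sub>1 [z]\<^sub>q = z\<close> is used.\<close>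

definition qnum :: "'a::complete_ultrametric_field \<Rightarrow> 'a \<Rightarrow> 'a" where
  "qnum q z = (if q = 1 then z else (1 - padic_pow q z) / (1 - q))"

definition fermionic_integral :: "nat \<Rightarrow> ('a::complete_ultrametric_field \<Rightarrow> 'a) \<Rightarrow> 'a" where
  "fermionic_integral p f = lim (\<lambda>N. \<Sum>x<p ^ N. f (of_nat x) * (- 1) ^ x)"

text \<open>
  Points of \<open>\<int>\<^sub>p\<^sup>r\<close> are functions on the index set \<open>{1..r}\<close>.  The integration over \<open>x\<^sub>1\<close> is innermost,
  the one over \<open>x\<^sub>r\<close> outermost.
\<close>

primrec iterated_fermionic_integral ::
  "nat \<Rightarrow> nat \<Rightarrow> ((nat \<Rightarrow> 'a::complete_ultrametric_field) \<Rightarrow> 'a) \<Rightarrow> 'a" where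
  "iterated_fermionic_integral p 0 F = F (\<lambda>_. 0)"
| "iterated_fermionic_integral p (Suc r) F =
     fermionic_integral p (\<lambda>t. iterated_fermionic_integral p r (\<lambda>x. F (x(Suc r := t))))"

text \<open>\<open>twisted_q_euler p r n w q y\<close> is \<open>E\<^bsub>n,w,q\<^esub>\<^bsup>(r-1,r)\<^esup>(y)\<close>, for \<open>y \<in> \<int>\<^sub>p\<close>.\<close>

definition twisted_q_euler ::
  "nat \<Rightarrow> nat \<Rightarrow> nat \<Rightarrow> 'a::complete_ultrametric_field \<Rightarrow> 'a \<Rightarrow> 'a \<Rightarrow> 'a" where
  "twisted_q_euler p r n w q y =
     iterated_fermionic_integral p r (\<lambda>x.
       padic_pow w (\<Sum>i=1..r. x i) *
       qnum q (y + (\<Sum>i=1..r. x i)) ^ n *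
       padic_pow q (\<Sum>i=1..r. of_nat (r - i) * x i))"

lemma padic_pow_of_nat: "padic_pow q (of_nat n) = q ^ n"
proof -
  have "(\<lambda>k. (of_nat n gchoose k) * (q - 1) ^ k) sums (\<Sum>k\<le>n. (of_nat n gchoose k) * (q - 1) ^ k)"
    by (rule sums_finite) (auto simp flip: binomial_gbinomial)
  also have "(\<Sum>k\<le>n. (of_nat n gchoose k) * (q - 1) ^ k) = ((q - 1) + 1) ^ n"
    by (subst binomial_ring) (simp flip: binomial_gbinomial)
  finally show ?thesis
    by (simp add: padic_pow_def sums_iff)
qed

lemma vabs_one: "vabs (1 :: 'a::complete_ultrametric_field) = 1"
proof -
  have "vabs (1 :: 'a) \<noteq> 0"
    using dist_vabs[of "1 :: 'a" 0] by (metis diff_zero dist_eq_0_iff zero_neq_one)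
  moreover have "vabs (1 :: 'a) = vabs (1 :: 'a) * vabs (1 :: 'a)"
    using vabs_mult[of "1 :: 'a" 1] by simp
  ultimately show ?thesis by simp
qed

lemma vabs_uminus: "vabs (- x) = vabs (x :: 'a::complete_ultrametric_field)"
  using dist_vabs[of x 0] dist_vabs[of 0 x] by (simp add: dist_commute)

lemma vabs_power: "vabs (x ^ n) = vabs (x :: 'a::complete_ultrametric_field) ^ n"
  by (induction n) (simp_all add: vabs_one vabs_mult)

lemma vabs_nonneg: "vabs (x :: 'a::complete_ultrametric_field) \<ge> 0"
  using dist_vabs[of x 0] by (metis diff_zero zero_le_dist)

lemma vabs_pos: "x \<noteq> 0 \<Longrightarrow> vabs (x :: 'a::complete_ultrametric_field) > 0"
  using dist_vabs[of x 0] by (metis diff_zero zero_less_dist_iff)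

lemma vabs_of_nat_le: "vabs (of_nat n :: 'a::complete_ultrametric_field) \<le> 1"
proof (induction n)
  case 0
  show ?case using dist_vabs[of "0 :: 'a" 0] by simp
next
  case (Suc n)
  then show ?case using vabs_add_le_max[of "1 :: 'a" "of_nat n"] by (simp add: vabs_one)
qed

lemma vabs_of_int_le: "vabs (of_int m :: 'a::complete_ultrametric_field) \<le> 1"
  by (cases m) (simp_all only: of_int_of_nat_eq of_int_minus vabs_uminus vabs_of_nat_le)

lemma Zp_divide_of_nat:
  fixes z :: "'a::complete_ultrametric_field"
  assumes Cp: "is_Cp p TYPE('a)" and d: "\<not> p dvd d" and z: "z \<in> Zp"
  shows "z / of_nat d \<in> Zp"
  unfolding Zp_def closure_approachable
proof (intro allI impI)
  fix e :: real assume e: "e > 0"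
  have p: "prime p" and vp: "vabs (of_nat p :: 'a) = 1 / real p"
    using Cp by (auto simp: is_Cp_def)
  have d0: "d \<noteq> 0" using d by (metis dvd_0_right)
  define c where "c = vabs (of_nat d :: 'a)"
  have c: "c > 0" unfolding c_def using d0 by (intro vabs_pos) simp
  obtain m where m: "dist (of_int m) z < e * c"
    using z e c unfolding Zp_def closure_approachable Ints_def
    by (metis (no_types, lifting) imageE mult_pos_pos)
  have "1 / real p < 1" using prime_gt_1_nat[OF p] by simp
  then obtain N where N: "(1 / real p) ^ N < e * c"
    using real_arch_pow_inv[of "e * c" "1 / real p"] e c by auto
  have "coprime d (p ^ N)"
    using prime_imp_coprime[OF p d] by (simp add: coprime_commute)
  then have "coprime (int d) (int p ^ N)"
    by (metis coprime_int_iff of_nat_power)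
  then obtain k0 where "[int d * k0 = 1] (mod (int p ^ N))"
    using cong_solve_coprime_int by blast
  then have "[int d * k0 * m = 1 * m] (mod (int p ^ N))"
    by (rule cong_scalar_right)
  then obtain l where l: "int d * k0 * m - m = int p ^ N * l"
    by (auto simp: cong_iff_dvd_diff dvd_def)
  define k where "k = k0 * m"
  have kl: "of_int m - of_nat d * of_int k = (- (of_nat p ^ N * of_int l) :: 'a)"
  proof -
    have "m - int d * k = - (int p ^ N * l)" using l by (simp add: k_def mult.assoc)
    then have "(of_int (m - int d * k) :: 'a) = of_int (- (int p ^ N * l))" by simp
    then show ?thesis by simp
  qed
  have "vabs (of_int m - of_nat d * of_int k :: 'a) = (1 / real p) ^ N * vabs (of_int l :: 'a)"
    unfolding kl by (simp add: vabs_uminus vabs_mult vabs_power vp)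
  also have "\<dots> \<le> (1 / real p) ^ N * 1"
    by (intro mult_left_mono vabs_of_int_le) simp
  finally have 1: "vabs (of_int m - of_nat d * of_int k :: 'a) < e * c" using N by simp
  have "vabs (z - of_int m) < e * c"
    using m by (simp add: dist_commute flip: dist_vabs)
  then have "vabs (z - of_nat d * of_int k) < e * c"
    using 1 vabs_add_le_max[of "z - of_int m" "of_int m - of_nat d * of_int k"] by simp
  also have "z - of_nat d * of_int k = (z / of_nat d - of_int k) * of_nat d"
    using d0 by (simp add: field_simps)
  finally have "vabs (z / of_nat d - of_int k) < e"
    using c by (simp add: vabs_mult flip: c_def)
  then have "dist (of_int k) (z / of_nat d) < e"
    by (simp add: dist_commute flip: dist_vabs)
  then show "\<exists>y\<in>\<int>. dist y (z / of_nat d) < e" by (intro bexI) auto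
qed

text \<open>
  Hence \<open>(a\<^sub>1 + \<dots> + a\<^sub>r + x)/d\<close> is an admissible argument of \<open>E\<close> whenever \<open>p\<close> does not divide \<open>d\<close>.
\<close>

lemma Zp_add_of_nat:
  fixes x :: "'a::complete_ultrametric_field"
  assumes "x \<in> Zp"
  shows "of_nat m + x \<in> Zp"
  unfolding Zp_def closure_approachable
proof (intro allI impI)
  fix e :: real assume "e > 0"
  then obtain y where y: "y \<in> \<int>" "dist y x < e"
    using assms unfolding Zp_def closure_approachable by blast
  have "dist (of_nat m + y) (of_nat m + x) < e" using y by (simp add: dist_vabs)
  moreover have "of_nat m + y \<in> \<int>" using y by simp
  ultimately show "\<exists>y\<in>\<int>. dist y (of_nat m + x) < e" by blast
qed

lemma Zp_argument:
  fixes x :: "'a::complete_ultrametric_field"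
  assumes "is_Cp p TYPE('a)" and "\<not> p dvd d" and "x \<in> Zp"
  shows "(of_nat m + x) / of_nat d \<in> Zp"
  using assms by (intro Zp_divide_of_nat Zp_add_of_nat)

end

theory Submission
  imports Defs "HOL-Analysis.Uniform_Limit"
begin

text \<open>
  For odd \<open>d\<close>, the alternating sums of a uniformly continuous \<open>f\<close> over \<open>{..<p\<^sup>N}\<close> and over
  \<open>{..<d p\<^sup>N}\<close> have the same limit: the latter splits into \<open>d\<close> blocks of length \<open>p\<^sup>N\<close> with
  alternating signs, on each of which \<open>f\<close> takes nearly the same values.  (For \<open>d = p\<close> this gives
  convergence, as the field is ultrametric and complete.)  Splitting the second sum by residues modulo
  \<open>d\<close> instead yields \<open>\<integral>f(t) = \<Sum>\<^sub>a\<^sub><\<^sub>d (-1)\<^sup>a \<integral>f(a + d t)\<close>.  Iterating this over the \<open>r\<close> variables and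
  using \<open>[d z]\<^sub>q = [d]\<^sub>q [z]\<close>, the last bracket being taken with respect to \<open>q\<^sup>d\<close>, gives the theorem.
\<close>

section \<open>Topology of a complete ultrametric field\<close>

text \<open>The class itself only provides a metric. This instance and the next one make the general
  limit and continuity rules for sums and products applicable.\<close>

instance complete_ultrametric_field \<subseteq> topological_ab_group_add
proof
  fix a b :: 'a
  show "LIM x (nhds a \<times>\<^sub>F nhds b). fst x + snd x :> nhds (a + b)"
    unfolding tendsto_iff
  proof (intro allI impI)
    fix e :: real assume e: "e > 0"
    have "\<forall>\<^sub>F x in nhds a \<times>\<^sub>F nhds b. dist (fst x) a < e"
      using filterlim_fst[of "nhds a" "nhds b"] e unfolding tendsto_iff by blast
    moreover have "\<forall>\<^sub>F x in nhds a \<times>\<^sub>F nhds b. dist (snd x) b < e"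
      using filterlim_snd[of "nhds b" "nhds a"] e unfolding tendsto_iff by blast
    ultimately show "\<forall>\<^sub>F x in nhds a \<times>\<^sub>F nhds b. dist (fst x + snd x) (a + b) < e"
    proof eventually_elim
      case (elim x)
      then show ?case
        using vabs_add_le_max[of "fst x - a" "snd x - b"]
        by (auto simp: dist_vabs algebra_simps)
    qed
  qed
  show "(uminus \<longlongrightarrow> - a) (nhds a)"
    unfolding tendsto_iff
  proof (intro allI impI)
    fix e :: real assume "e > 0"
    then have "\<forall>\<^sub>F x in nhds a. dist x a < e"
      using filterlim_ident[of "nhds a"] unfolding tendsto_iff by blast
    then show "\<forall>\<^sub>F x in nhds a. dist (- x) (- a) < e"
    proof eventually_elim
      case (elim x)
      then show ?case using vabs_uminus[of "x - a"] by (simp add: dist_vabs)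
    qed
  qed
qed

instance complete_ultrametric_field \<subseteq> topological_comm_monoid_mult
proof
  fix a b :: 'a
  show "LIM x (nhds a \<times>\<^sub>F nhds b). fst x * snd x :> nhds (a * b)"
    unfolding tendsto_iff
  proof (intro allI impI)
    fix e :: real assume e: "e > 0"
    \<comment> \<open>With \<open>u\<close> and \<open>v\<close> the errors of the factors, the
      error of the product is \<open>u * v + (u * b + v * a)\<close>. This \<open>\<delta>\<close>
      makes each of the three terms smaller than \<open>e\<close>; the first one also uses
      \<open>\<delta> \<le> 1\<close>.\<close>
    define \<delta> where "\<delta> = min 1 (e / (1 + vabs a + vabs b))"
    have pos: "1 + vabs a + vabs b > 0"
      using vabs_nonneg[of a] vabs_nonneg[of b] by linarith
    have \<delta>: "\<delta> > 0" "\<delta> \<le> 1" "\<delta> * (1 + vabs a + vabs b) \<le> e"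
      using e pos by (auto simp: \<delta>_def simp flip: pos_le_divide_eq)
    have \<delta>_le: "\<delta> \<le> e" "\<delta> * vabs a \<le> e" "\<delta> * vabs b \<le> e"
      using \<delta> mult_nonneg_nonneg[of \<delta> "vabs a"] mult_nonneg_nonneg[of \<delta> "vabs b"]
        vabs_nonneg[of a] vabs_nonneg[of b] unfolding distrib_left by linarith+
    have "\<forall>\<^sub>F x in nhds a \<times>\<^sub>F nhds b. dist (fst x) a < \<delta>"
      using filterlim_fst[of "nhds a" "nhds b"] \<delta> unfolding tendsto_iff by blast
    moreover have "\<forall>\<^sub>F x in nhds a \<times>\<^sub>F nhds b. dist (snd x) b < \<delta>"
      using filterlim_snd[of "nhds b" "nhds a"] \<delta> unfolding tendsto_iff by blast
    ultimately show "\<forall>\<^sub>F x in nhds a \<times>\<^sub>F nhds b. dist (fst x * snd x) (a * b) < e"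
    proof eventually_elim
      case (elim x)
      define u v where "u = fst x - a" and "v = snd x - b"
      have u: "vabs u < \<delta>" and v: "vabs v < \<delta>"
        using elim by (auto simp: u_def v_def dist_vabs)
      have less: "vabs (y * c) < e" if y: "vabs y < \<delta>" and c: "\<delta> * vabs c \<le> e" for y c :: 'a
      proof (cases "c = 0")
        case True
        then show ?thesis using e dist_vabs[of "0::'a" 0] by simp
      next
        case False
        then show ?thesis using mult_strict_right_mono[OF y vabs_pos[OF False]] c
          by (simp add: vabs_mult)
      qed
      have "vabs v \<le> 1" using v \<delta> by simp
      then have "\<delta> * vabs v \<le> \<delta> * 1" using \<delta> by (intro mult_left_mono) auto
      then have "\<delta> * vabs v \<le> e" using \<delta>_le by simp
      then have "vabs (u * v) < e" "vabs (u * b) < e" "vabs (v * a) < e"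
        using less u v \<delta>_le by auto
      then have "vabs (u * v + (u * b + v * a)) < e"
        using vabs_add_le_max[of "u * v" "u * b + v * a"] vabs_add_le_max[of "u * b" "v * a"]
        by auto
      also have "u * v + (u * b + v * a) = fst x * snd x - a * b"
        by (simp add: u_def v_def algebra_simps)
      finally show ?case by (simp add: dist_vabs)
    qed
  qed
qed

section \<open>Estimates and convergence criteria for an ultrametric absolute value\<close>

lemma vabs_zero: "vabs (0 :: 'a::complete_ultrametric_field) = 0"
  using dist_vabs[of "0::'a" 0] by simp

lemma vabs_diff_le_max: "vabs (x - y) \<le> max (vabs x) (vabs (y :: 'a::complete_ultrametric_field))"
  using vabs_add_le_max[of x "- y"] by (simp add: vabs_uminus)

lemma vabs_neg_one_power: "vabs ((- 1) ^ n :: 'a::complete_ultrametric_field) = 1"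
  by (simp add: vabs_power vabs_uminus vabs_one)

text \<open>By the ultrametric inequality the bound does not grow with the number of terms, so it
  applies to Riemann sums of any length. \<open>C \<ge> 0\<close> covers the empty sum.\<close>

lemma vabs_sum_le:
  fixes f :: "'b \<Rightarrow> 'a::complete_ultrametric_field"
  assumes "\<And>i. i \<in> A \<Longrightarrow> vabs (f i) \<le> C" and "C \<ge> 0"
  shows "vabs (sum f A) \<le> C"
  using assms
proof (induction A rule: infinite_finite_induct)
  case (insert i A)
  then show ?case using vabs_add_le_max[of "f i" "sum f A"] by fastforce
qed (auto simp: vabs_zero)

lemma vabs_limit_le:
  fixes X :: "nat \<Rightarrow> 'a::complete_ultrametric_field"
  assumes "X \<longlonglongrightarrow> l" and "\<And>n. vabs (X n) \<le> C"
  shows "vabs l \<le> C"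
proof -
  have "(\<lambda>n. dist (X n) 0) \<longlonglongrightarrow> dist l 0"
    by (intro tendsto_dist assms tendsto_const)
  then show ?thesis
    using assms(2) by (intro LIMSEQ_le_const2[of _ "vabs l"]) (auto simp: dist_vabs)
qed

lemma tendsto_zero_vabs_iff:
  fixes X :: "nat \<Rightarrow> 'a::complete_ultrametric_field"
  shows "X \<longlonglongrightarrow> 0 \<longleftrightarrow> (\<lambda>n. vabs (X n)) \<longlonglongrightarrow> 0"
  by (subst tendsto_dist_iff) (simp add: dist_vabs)

text \<open>\<open>X (m + k) - X m\<close> telescopes into consecutive differences and is bounded by
  the largest of them, so the sequence is Cauchy.\<close>

lemma ultrametric_convergent:
  fixes X :: "nat \<Rightarrow> 'a::complete_ultrametric_field"
  assumes "(\<lambda>n. X (Suc n) - X n) \<longlonglongrightarrow> 0"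
  shows "convergent X"
proof -
  have "Cauchy X"
    unfolding Cauchy_altdef
  proof (intro allI impI)
    fix e :: real assume e: "e > 0"
    then obtain M where M: "\<And>n. n \<ge> M \<Longrightarrow> vabs (X (Suc n) - X n) < e"
      using assms unfolding lim_sequentially dist_vabs by (metis diff_zero)
    have "dist (X m) (X n) < e" if "m \<ge> M" "n > m" for m n
    proof -
      have "dist (X m) (X (m + k)) < e" for k
      proof (induction k)
        case (Suc k)
        have "vabs (X (Suc (m + k)) - X (m + k)) < e" using M that by simp
        then show ?case
          using Suc vabs_diff_le_max[of "X m - X (m + k)" "X (Suc (m + k)) - X (m + k)"]
          by (auto simp: dist_vabs)
      qed (use e in simp)
      from this[of "n - m"] show ?thesis using that by simp
    qed
    then show "\<exists>M. \<forall>m\<ge>M. \<forall>n>m. dist (X m) (X n) < e" by blast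
  qed
  then show ?thesis by (simp add: Cauchy_convergent_iff)
qed

lemma ultrametric_summable:
  fixes f :: "nat \<Rightarrow> 'a::complete_ultrametric_field"
  assumes "f \<longlonglongrightarrow> 0"
  shows "summable f"
  unfolding summable_iff_convergent by (rule ultrametric_convergent) (use assms in simp)

section \<open>The \<open>p\<close>-adic power function\<close>

lemma vabs_one_minus_commute: "vabs (q - 1) = vabs (1 - q :: 'a::complete_ultrametric_field)"
  using vabs_uminus[of "1 - q"] by simp

lemma vabs_le_one_Zp:
  fixes z :: "'a::complete_ultrametric_field"
  assumes "z \<in> Zp"
  shows "vabs z \<le> 1"
proof -
  obtain X where X: "\<And>n. X n \<in> \<int>" "X \<longlonglongrightarrow> z"
    using assms unfolding Zp_def closure_sequential by blast
  have "vabs (X n) \<le> 1" for n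
    using Ints_cases[OF X(1)[of n]] vabs_of_int_le by metis
  then show ?thesis by (rule vabs_limit_le[OF X(2)])
qed

lemma Ints_subset_Zp: "\<int> \<subseteq> Zp"
  unfolding Zp_def by (rule closure_subset)

lemma Zp_mult_of_nat:
  fixes z :: "'a::complete_ultrametric_field"
  assumes "z \<in> Zp"
  shows "of_nat d * z \<in> Zp"
proof -
  obtain X where "\<And>n. X n \<in> \<int>" "X \<longlonglongrightarrow> z"
    using assms unfolding Zp_def closure_sequential by blast
  then have "(\<lambda>n. of_nat d * X n) \<longlonglongrightarrow> of_nat d * z" "\<And>n. of_nat d * X n \<in> \<int>"
    by (auto intro!: tendsto_mult tendsto_const)
  then show ?thesis unfolding Zp_def closure_sequential by (intro exI[of _ "\<lambda>n. of_nat d * X n"]) auto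
qed

section \<open>Binomial coefficients on the p-adic integers\<close>

lemma continuous_on_gbinomial:
  "continuous_on A (\<lambda>z :: 'a::complete_ultrametric_field. z gchoose k)"
proof -
  have "continuous_on A (\<lambda>z :: 'a. (\<Prod>i = 0..<k. z - of_nat i) * inverse (fact k))"
    by (intro continuous_intros)
  then show ?thesis by (simp add: gbinomial_prod_rev divide_inverse)
qed

text \<open>Binomial coefficients with an integer upper entry are integers; a negative entry is
  reduced to a natural one by upper negation.\<close>

lemma vabs_gbinomial_Ints_le:
  fixes z :: "'a::complete_ultrametric_field"
  assumes "z \<in> \<int>"
  shows "vabs (z gchoose k) \<le> 1"
proof -
  have nat: "vabs (of_nat n gchoose k :: 'a) \<le> 1" for n
    by (simp flip: binomial_gbinomial add: vabs_of_nat_le)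
  obtain m where m: "z = of_int m" using Ints_cases[OF assms] .
  show ?thesis
  proof (cases "m \<ge> 0")
    case True
    then show ?thesis using nat[of "nat m"] m by simp
  next
    case False
    have "of_nat k - z - 1 = of_nat (nat (int k - m - 1))"
      using False m by simp
    then have "z gchoose k = (- 1) ^ k * (of_nat (nat (int k - m - 1)) gchoose k)"
      by (subst gbinomial_negated_upper) simp
    then show ?thesis using nat by (simp add: vabs_mult vabs_neg_one_power)
  qed
qed

text \<open>The bound on the integers survives limits, because the binomial coefficient is a
  polynomial in \<open>z\<close>.\<close>

lemma vabs_gbinomial_Zp_le:
  fixes z :: "'a::complete_ultrametric_field"
  assumes "z \<in> Zp"
  shows "vabs (z gchoose k) \<le> 1"
proof -
  obtain X where X: "\<And>n. X n \<in> \<int>" "X \<longlonglongrightarrow> z"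
    using assms unfolding Zp_def closure_sequential by blast
  have "(\<lambda>n. X n gchoose k) \<longlonglongrightarrow> z gchoose k"
    by (rule continuous_on_tendsto_compose[OF continuous_on_gbinomial[of UNIV] X(2)]) auto
  then show ?thesis
    by (rule vabs_limit_le) (use X vabs_gbinomial_Ints_le in blast)
qed

lemma vabs_padic_pow_term_le:
  fixes q z :: "'a::complete_ultrametric_field"
  assumes "z \<in> Zp"
  shows "vabs ((z gchoose k) * (q - 1) ^ k) \<le> vabs (1 - q) ^ k"
  using mult_right_mono[OF vabs_gbinomial_Zp_le[OF assms, of k], of "vabs (1 - q) ^ k"]
  by (simp add: vabs_mult vabs_power vabs_one_minus_commute vabs_nonneg)

lemma padic_pow_sums:
  fixes q z :: "'a::complete_ultrametric_field"
  assumes "vabs (1 - q) < 1" and "z \<in> Zp"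
  shows "(\<lambda>k. (z gchoose k) * (q - 1) ^ k) sums padic_pow q z"
proof -
  have "(\<lambda>k. vabs ((z gchoose k) * (q - 1) ^ k)) \<longlonglongrightarrow> 0"
  proof (rule tendsto_sandwich[OF _ _ tendsto_const])
    show "(\<lambda>k. vabs (1 - q) ^ k) \<longlonglongrightarrow> 0"
      using assms by (intro LIMSEQ_power_zero) (simp add: vabs_nonneg)
  qed (auto intro!: always_eventually vabs_padic_pow_term_le assms simp: vabs_nonneg)
  then show ?thesis
    unfolding padic_pow_def
    by (intro summable_sums ultrametric_summable) (simp add: tendsto_zero_vabs_iff)
qed

text \<open>The partial sums are polynomials in \<open>z\<close>, and they converge uniformly: from
  index \<open>M\<close> on, the tail is at most \<open>vabs (1 - q) ^ M\<close> for every
  \<open>z\<close> in \<open>Zp\<close>.\<close>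

lemma continuous_on_padic_pow:
  fixes q :: "'a::complete_ultrametric_field"
  assumes "vabs (1 - q) < 1"
  shows "continuous_on Zp (padic_pow q)"
proof (rule uniform_limit_theorem)
  let ?S = "\<lambda>N z. \<Sum>k<N. (z gchoose k) * (q - 1) ^ k"
  show "\<forall>\<^sub>F N in sequentially. continuous_on Zp (?S N)"
    by (intro always_eventually allI continuous_intros continuous_on_gbinomial)
  show "uniform_limit Zp ?S (padic_pow q) sequentially"
  proof (rule uniform_limitI)
    fix e :: real assume "e > 0"
    then obtain M where M: "vabs (1 - q) ^ M < e"
      using real_arch_pow_inv assms by blast
    have "dist (?S N z) (padic_pow q z) < e" if "N \<ge> M" "z \<in> Zp" for N z
    proof -
      have lim: "(\<lambda>n. ?S n z - ?S N z) \<longlonglongrightarrow> padic_pow q z - ?S N z"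
        using padic_pow_sums[OF assms \<open>z \<in> Zp\<close>] unfolding sums_def
        by (intro tendsto_diff tendsto_const)
      have "vabs (?S (n + N) z - ?S N z) \<le> vabs (1 - q) ^ M" for n
      proof -
        have "?S (n + N) z - ?S N z = (\<Sum>k=N..<n+N. (z gchoose k) * (q - 1) ^ k)"
          by (simp add: sum_diff_nat_ivl lessThan_atLeast0)
        also have "vabs \<dots> \<le> vabs (1 - q) ^ M"
        proof (rule vabs_sum_le)
          fix k assume "k \<in> {N..<n+N}"
          then have "vabs (1 - q) ^ k \<le> vabs (1 - q) ^ M"
            using \<open>N \<ge> M\<close> assms by (intro power_decreasing) (auto simp: vabs_nonneg)
          then show "vabs ((z gchoose k) * (q - 1) ^ k) \<le> vabs (1 - q) ^ M"
            using vabs_padic_pow_term_le[OF \<open>z \<in> Zp\<close>, of k q] by linarith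
        qed (simp add: vabs_nonneg)
        finally show ?thesis .
      qed
      then have "vabs (padic_pow q z - ?S N z) \<le> vabs (1 - q) ^ M"
        using LIMSEQ_ignore_initial_segment[OF lim, of N] by (rule vabs_limit_le[rotated])
      then have "dist (padic_pow q z) (?S N z) < e" using M by (simp add: dist_vabs)
      then show ?thesis by (simp only: dist_commute)
    qed
    then show "\<forall>\<^sub>F N in sequentially. \<forall>z\<in>Zp. dist (?S N z) (padic_pow q z) < e"
      unfolding eventually_sequentially by blast
  qed
qed simp

text \<open>Pascal's rule splits each coefficient of \<open>z + 1\<close> in two; the shifted half
  contributes \<open>q - 1\<close> times the original series.\<close>

lemma padic_pow_add_one:
  fixes q z :: "'a::complete_ultrametric_field"
  assumes "vabs (1 - q) < 1" and "z \<in> Zp"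
  shows "padic_pow q (z + 1) = q * padic_pow q z"
proof -
  define f where "f = (\<lambda>k. (z gchoose k) * (q - 1) ^ k)"
  have S: "(\<lambda>N. \<Sum>k<N. f k) \<longlonglongrightarrow> padic_pow q z"
    using padic_pow_sums[OF assms] by (simp add: f_def sums_def)
  have eq: "(\<Sum>k<Suc N. ((z + 1) gchoose k) * (q - 1) ^ k) =
      (\<Sum>k<Suc N. f k) + (q - 1) * (\<Sum>k<N. f k)" for N
  proof -
    have "((z + 1) gchoose Suc k) * (q - 1) ^ Suc k = f (Suc k) + (q - 1) * f k" for k
      unfolding f_def gbinomial_Suc_Suc by (simp add: distrib_right)
    then show ?thesis
      unfolding sum.lessThan_Suc_shift by (simp add: f_def sum.distrib sum_distrib_left)
  qed
  have "(\<lambda>N. (\<Sum>k<Suc N. f k) + (q - 1) * (\<Sum>k<N. f k)) \<longlonglongrightarrow>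
      padic_pow q z + (q - 1) * padic_pow q z"
    using S LIMSEQ_Suc[OF S] by (intro tendsto_intros)
  then have "(\<lambda>N. \<Sum>k<N. ((z + 1) gchoose k) * (q - 1) ^ k) \<longlonglongrightarrow> q * padic_pow q z"
    unfolding eq[symmetric] by (subst (asm) filterlim_sequentially_Suc) (simp add: algebra_simps)
  then show ?thesis
    unfolding padic_pow_def[of q "z + 1"] by (metis sums_def sums_unique)
qed

lemma padic_pow_add_of_nat:
  fixes q z :: "'a::complete_ultrametric_field"
  assumes "vabs (1 - q) < 1" and "z \<in> Zp"
  shows "padic_pow q (z + of_nat m) = padic_pow q z * q ^ m"
proof (induction m)
  case (Suc m)
  have "padic_pow q (z + of_nat m + 1) = q * padic_pow q (z + of_nat m)"
    using assms Zp_add_of_nat[of z m] by (intro padic_pow_add_one) (auto simp: add.commute)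
  then show ?case using Suc by (simp add: algebra_simps)
qed simp

text \<open>This is the addition rule at \<open>z = - of_nat m\<close>, where the left side becomes
  the power with exponent zero.\<close>

lemma padic_pow_minus_of_nat:
  fixes q :: "'a::complete_ultrametric_field"
  assumes "vabs (1 - q) < 1"
  shows "padic_pow q (- of_nat m) = inverse (q ^ m)"
proof -
  have "- of_nat m \<in> (Zp :: 'a set)"
    using Ints_subset_Zp by (metis Ints_minus Ints_of_nat subsetD)
  then have "padic_pow q (- of_nat m) * q ^ m = 1"
    using padic_pow_add_of_nat[OF assms, of "- of_nat m" m] padic_pow_of_nat[of q 0] by simp
  then show ?thesis by (intro inverse_unique[symmetric]) (simp add: mult.commute)
qed

text \<open>Induction, as \<open>q ^ Suc m - 1 = q * (q ^ m - 1) - (1 - q)\<close> and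
  \<open>vabs q \<le> 1\<close>. In particular \<open>q ^ d\<close> inherits the smallness condition
  imposed on \<open>q\<close>.\<close>

lemma vabs_power_minus_one_le:
  fixes q :: "'a::complete_ultrametric_field"
  assumes "vabs (1 - q) \<le> 1"
  shows "vabs (q ^ m - 1) \<le> vabs (1 - q)"
proof (induction m)
  case (Suc m)
  have q: "vabs q \<le> 1"
    using vabs_diff_le_max[of 1 "1 - q"] assms by (simp add: vabs_one)
  have eq: "q ^ Suc m - 1 = q * (q ^ m - 1) - (1 - q)" by (simp add: algebra_simps)
  have "vabs (q * (q ^ m - 1)) \<le> vabs (1 - q)"
    using mult_mono[OF q Suc] by (simp add: vabs_mult vabs_nonneg)
  then show ?case
    using vabs_diff_le_max[of "q * (q ^ m - 1)" "1 - q"] unfolding eq by simp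
qed (simp add: vabs_zero vabs_nonneg)

text \<open>Both sides are continuous in \<open>z\<close> on \<open>Zp\<close> and agree on the
  dense subset of integers.\<close>

lemma padic_pow_mult_of_nat:
  fixes q z :: "'a::complete_ultrametric_field"
  assumes q: "vabs (1 - q) < 1" and z: "z \<in> Zp"
  shows "padic_pow q (of_nat d * z) = padic_pow (q ^ d) z"
proof -
  have qd: "vabs (1 - q ^ d) < 1"
    using q vabs_power_minus_one_le[of q d] by (simp add: vabs_one_minus_commute)
  have Ints: "padic_pow q (of_nat d * y) = padic_pow (q ^ d) y" if y: "y \<in> \<int>" for y
  proof -
    obtain m where m: "y = of_int m" using Ints_cases[OF y] .
    show ?thesis
    proof (cases m)
      case (nonneg n)
      then show ?thesis using m padic_pow_of_nat[of q "d * n"] padic_pow_of_nat[of "q ^ d" n]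
        by (simp add: power_mult)
    next
      \<comment> \<open>This constructor stands for the integer \<open>- (n + 1)\<close>, hence the
        exponents \<open>Suc n\<close>.\<close>
      case (neg n)
      then have "y = - of_nat (Suc n)" using m by simp
      then show ?thesis
        using padic_pow_minus_of_nat[OF q, of "d * Suc n"] padic_pow_minus_of_nat[OF qd, of "Suc n"]
        by (simp only: power_mult of_nat_mult mult_minus_right)
    qed
  qed
  obtain X where X: "\<And>n. X n \<in> \<int>" "X \<longlonglongrightarrow> z"
    using z unfolding Zp_def closure_sequential by blast
  have XZ: "X n \<in> Zp" for n using X Ints_subset_Zp by blast
  have "(\<lambda>n. padic_pow q (of_nat d * X n)) \<longlonglongrightarrow> padic_pow q (of_nat d * z)"
    by (rule continuous_on_tendsto_compose[OF continuous_on_padic_pow[OF q]])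
       (use X XZ z in \<open>auto intro!: tendsto_mult tendsto_const Zp_mult_of_nat always_eventually\<close>)
  moreover have "(\<lambda>n. padic_pow (q ^ d) (X n)) \<longlonglongrightarrow> padic_pow (q ^ d) z"
    by (rule continuous_on_tendsto_compose[OF continuous_on_padic_pow[OF qd] X(2)])
       (use XZ z in auto)
  ultimately show ?thesis
    unfolding Ints[OF X(1)] by (rule LIMSEQ_unique)
qed

text \<open>If \<open>q ^ d = 1\<close> with \<open>q \<noteq> 1\<close>, the geometric sum of the
  powers of \<open>q\<close> vanishes. Each power is close to 1, so \<open>of_nat d\<close> would be
  small, which a unit is not. Hence \<open>qnum\<close> falls into the same case for
  \<open>q\<close> and for \<open>q ^ d\<close>.\<close>

lemma power_eq_one_iff_of_vabs_one:
  fixes q :: "'a::complete_ultrametric_field"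
  assumes q: "vabs (1 - q) < 1" and d: "vabs (of_nat d :: 'a) = 1"
  shows "q ^ d = 1 \<longleftrightarrow> q = 1"
proof
  assume "q ^ d = 1"
  show "q = 1"
  proof (rule ccontr)
    assume "q \<noteq> 1"
    then have "(\<Sum>i<d. q ^ i) = 0"
      using \<open>q ^ d = 1\<close> by (simp add: sum_gp_strict)
    then have "of_nat d = - (\<Sum>i<d. q ^ i - 1)"
      by (simp add: sum_subtractf)
    also have "vabs \<dots> \<le> vabs (1 - q)"
      unfolding vabs_uminus by (intro vabs_sum_le vabs_power_minus_one_le)
        (use q in \<open>auto simp: vabs_nonneg\<close>)
    finally show False using d q by simp
  qed
qed simp

text \<open>For \<open>q \<noteq> 1\<close> the factor \<open>1 - q ^ d\<close> cancels between the
  two brackets on the right; for \<open>q = 1\<close> both sides are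
  \<open>of_nat d * z\<close>.\<close>

lemma qnum_mult_of_nat:
  fixes q z :: "'a::complete_ultrametric_field"
  assumes q: "vabs (1 - q) < 1" and d: "vabs (of_nat d :: 'a) = 1" and z: "z \<in> Zp"
  shows "qnum q (of_nat d * z) = qnum q (of_nat d) * qnum (q ^ d) z"
  using padic_pow_mult_of_nat[OF q z, of d] power_eq_one_iff_of_vabs_one[OF q d]
  by (auto simp: qnum_def padic_pow_of_nat)

section \<open>The fermionic integral of a uniformly continuous function\<close>

text \<open>Uniform continuity for the \<open>p\<close>-adic topology on the dense subset \<open>\<nat>\<close> of \<open>\<int>\<^sub>p\<close>; the
  Riemann sums of the fermionic integral only see these points.\<close>

definition padic_ucont :: "nat \<Rightarrow> (nat \<Rightarrow> 'a::complete_ultrametric_field) \<Rightarrow> bool" where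
  "padic_ucont p f \<longleftrightarrow> (\<forall>e>0. \<exists>N. \<forall>m m'. [m = m'] (mod p ^ N) \<longrightarrow> vabs (f m - f m') \<le> e)"

text \<open>Used in two ways: with \<open>M\<close> a power of \<open>p\<close> it cuts the range
  into \<open>d\<close> long blocks, and with the factors exchanged it sorts the range by residues
  modulo \<open>d\<close>.\<close>

lemma sum_lessThan_mult:
  "(\<Sum>x<d * M. g x) = (\<Sum>j<d. \<Sum>x<M. g (x + j * M))" for g :: "nat \<Rightarrow> 'a::comm_monoid_add"
proof -
  have "sum g {j * M..<j * M + M} = (\<Sum>x<M. g (x + j * M))" for j
    using sum.shift_bounds_nat_ivl[of g 0 "j * M" M] by (simp add: add.commute lessThan_atLeast0)
  then show ?thesis by (simp flip: sum.nat_group)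
qed

lemma sum_neg_one_power_odd: "odd d \<Longrightarrow> (\<Sum>j<d. (- 1) ^ j) = (1 :: 'a::field_char_0)"
  by (subst sum_gp_strict) auto

lemma vabs_alternating_sum_diff_le:
  fixes f :: "nat \<Rightarrow> 'a::complete_ultrametric_field"
  assumes "odd d" and "odd M" and "e \<ge> 0" and f: "\<And>x j. vabs (f (x + j * M) - f x) \<le> e"
  shows "vabs ((\<Sum>x<d * M. f x * (- 1) ^ x) - (\<Sum>x<M. f x * (- 1) ^ x)) \<le> e"
proof -
  have sign: "(- 1) ^ (j * M) = ((- 1) ^ j :: 'a)" for j
    using \<open>odd M\<close> by (simp add: minus_one_power_iff)
  \<comment> \<open>The short sum is multiplied by the alternating sum of length \<open>d\<close>,
    which is 1, so that it can be compared with the long sum block by block.\<close>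
  have "(\<Sum>x<M. f x * (- 1) ^ x) = (\<Sum>j<d. (- 1) ^ j) * (\<Sum>x<M. f x * (- 1) ^ x)"
    by (simp add: sum_neg_one_power_odd[OF \<open>odd d\<close>])
  also have "\<dots> = (\<Sum>j<d. \<Sum>x<M. f x * (- 1) ^ (x + j * M))"
    by (simp add: sum_product power_add sign mult_ac)
  finally have "(\<Sum>x<d * M. f x * (- 1) ^ x) - (\<Sum>x<M. f x * (- 1) ^ x) =
      (\<Sum>j<d. \<Sum>x<M. (f (x + j * M) - f x) * (- 1) ^ (x + j * M))"
    by (simp add: sum_lessThan_mult sum_subtractf left_diff_distrib)
  also have "vabs \<dots> \<le> e"
    by (intro vabs_sum_le) (simp_all add: vabs_mult vabs_neg_one_power f \<open>e \<ge> 0\<close>)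
  finally show ?thesis .
qed

lemma alternating_sum_diff_tendsto_zero:
  fixes f :: "nat \<Rightarrow> 'a::complete_ultrametric_field"
  assumes f: "padic_ucont p f" and "odd p" and "odd d"
  shows "(\<lambda>N. (\<Sum>x<d * p ^ N. f x * (- 1) ^ x) - (\<Sum>x<p ^ N. f x * (- 1) ^ x)) \<longlonglongrightarrow> 0"
  unfolding lim_sequentially
proof (intro allI impI)
  fix e :: real assume e: "e > 0"
  then obtain N where N: "\<And>m m'. [m = m'] (mod p ^ N) \<Longrightarrow> vabs (f m - f m') \<le> e / 2"
    using f unfolding padic_ucont_def by (metis half_gt_zero)
  have "dist ((\<Sum>x<d * p ^ K. f x * (- 1) ^ x) - (\<Sum>x<p ^ K. f x * (- 1) ^ x)) 0 < e"
    if "K \<ge> N" for K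
  proof -
    have "[x + j * p ^ K = x] (mod p ^ N)" for x j
      using le_imp_power_dvd[OF that, of p]
      by (simp add: cong_def mod_add_right_eq[symmetric] dvd_imp_mod_0 del: mod_add_right_eq)
    then have "vabs ((\<Sum>x<d * p ^ K. f x * (- 1) ^ x) - (\<Sum>x<p ^ K. f x * (- 1) ^ x)) \<le> e / 2"
      using assms e N by (intro vabs_alternating_sum_diff_le) auto
    then show ?thesis using e by (simp add: dist_vabs)
  qed
  then show "\<exists>N. \<forall>K\<ge>N.
      dist ((\<Sum>x<d * p ^ K. f x * (- 1) ^ x) - (\<Sum>x<p ^ K. f x * (- 1) ^ x)) 0 < e" by blast
qed

text \<open>The case \<open>d = p\<close> of the previous lemma says that consecutive Riemann sums
  differ by a null sequence. This ensures that the \<open>lim\<close> in the definition is an actual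
  limit.\<close>

lemma fermionic_integral_tendsto:
  fixes f :: "'a::complete_ultrametric_field \<Rightarrow> 'a"
  assumes "padic_ucont p (\<lambda>n. f (of_nat n))" and "odd p"
  shows "(\<lambda>N. \<Sum>x<p ^ N. f (of_nat x) * (- 1) ^ x) \<longlonglongrightarrow> fermionic_integral p f"
proof -
  have "convergent (\<lambda>N. \<Sum>x<p ^ N. f (of_nat x) * (- 1) ^ x)"
    using alternating_sum_diff_tendsto_zero[OF assms assms(2)]
    by (intro ultrametric_convergent) simp
  then show ?thesis unfolding fermionic_integral_def by (simp add: convergent_LIMSEQ_iff)
qed

lemma fermionic_integral_eqI:
  "(\<lambda>N. \<Sum>x<p ^ N. f (of_nat x) * (- 1) ^ x) \<longlonglongrightarrow> L \<Longrightarrow> fermionic_integral p f = L"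
  unfolding fermionic_integral_def by (rule limI)

lemma fermionic_integral_cong:
  "(\<And>n. f (of_nat n) = g (of_nat n)) \<Longrightarrow> fermionic_integral p f = fermionic_integral p g"
  by (simp add: fermionic_integral_def)

lemma padic_ucont_affine:
  assumes "padic_ucont p f"
  shows "padic_ucont p (\<lambda>n. f (a + d * n))"
  unfolding padic_ucont_def
proof (intro allI impI)
  fix e :: real assume "e > 0"
  then obtain N where N: "\<And>m m'. [m = m'] (mod p ^ N) \<Longrightarrow> vabs (f m - f m') \<le> e"
    using assms unfolding padic_ucont_def by blast
  then show "\<exists>N. \<forall>m m'. [m = m'] (mod p ^ N) \<longrightarrow> vabs (f (a + d * m) - f (a + d * m')) \<le> e"
    by (intro exI[of _ N]) (auto intro!: N cong_add cong_mult)
qed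

lemma fermionic_integral_distribution:
  fixes f :: "'a::complete_ultrametric_field \<Rightarrow> 'a"
  assumes f: "padic_ucont p (\<lambda>n. f (of_nat n))" and p: "odd p" and d: "odd d"
  shows "fermionic_integral p f =
    (\<Sum>a<d. (- 1) ^ a * fermionic_integral p (\<lambda>t. f (of_nat a + of_nat d * t)))"
proof (rule LIMSEQ_unique)
  have "(\<lambda>N. ((\<Sum>x<d * p ^ N. f (of_nat x) * (- 1) ^ x) - (\<Sum>x<p ^ N. f (of_nat x) * (- 1) ^ x)) +
      (\<Sum>x<p ^ N. f (of_nat x) * (- 1) ^ x)) \<longlonglongrightarrow> 0 + fermionic_integral p f"
    by (intro tendsto_add alternating_sum_diff_tendsto_zero fermionic_integral_tendsto assms)
  then show "(\<lambda>N. \<Sum>x<d * p ^ N. f (of_nat x) * (- 1) ^ x) \<longlonglongrightarrow> fermionic_integral p f"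
    by simp
  have sign: "(- 1) ^ (a + x * d) = ((- 1) ^ a * (- 1) ^ x :: 'a)" for a x
    using d by (simp add: minus_one_power_iff)
  have "(\<Sum>x<d * p ^ N. f (of_nat x) * (- 1) ^ x) =
      (\<Sum>a<d. (- 1) ^ a * (\<Sum>x<p ^ N. f (of_nat a + of_nat d * of_nat x) * (- 1) ^ x))" for N
    \<comment> \<open>The blocks now have length \<open>d\<close>, so the inner index is the residue
      \<open>a\<close>; the swap makes it the outer one.\<close>
    unfolding mult.commute[of d] sum_lessThan_mult
    by (subst sum.swap) (simp add: sign sum_distrib_left mult_ac)
  moreover have "(\<lambda>N. \<Sum>a<d. (- 1) ^ a * (\<Sum>x<p ^ N. f (of_nat a + of_nat d * of_nat x) * (- 1) ^ x))
      \<longlonglongrightarrow> (\<Sum>a<d. (- 1) ^ a * fermionic_integral p (\<lambda>t. f (of_nat a + of_nat d * t)))"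
    using padic_ucont_affine[OF f]
    by (intro tendsto_sum tendsto_mult tendsto_const fermionic_integral_tendsto p) simp
  ultimately show "(\<lambda>N. \<Sum>x<d * p ^ N. f (of_nat x) * (- 1) ^ x) \<longlonglongrightarrow>
      (\<Sum>a<d. (- 1) ^ a * fermionic_integral p (\<lambda>t. f (of_nat a + of_nat d * t)))"
    by simp
qed

lemma fermionic_integral_linear:
  fixes f :: "'b \<Rightarrow> 'a::complete_ultrametric_field \<Rightarrow> 'a"
  assumes "\<And>a. a \<in> A \<Longrightarrow> padic_ucont p (\<lambda>n. f a (of_nat n))" and "odd p"
  shows "fermionic_integral p (\<lambda>t. \<Sum>a\<in>A. c a * f a t) = (\<Sum>a\<in>A. c a * fermionic_integral p (f a))"
proof (rule fermionic_integral_eqI)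
  have "(\<lambda>N. \<Sum>a\<in>A. c a * (\<Sum>x<p ^ N. f a (of_nat x) * (- 1) ^ x)) \<longlonglongrightarrow>
      (\<Sum>a\<in>A. c a * fermionic_integral p (f a))"
    by (intro tendsto_sum tendsto_mult tendsto_const fermionic_integral_tendsto assms)
  also have "(\<lambda>N. \<Sum>a\<in>A. c a * (\<Sum>x<p ^ N. f a (of_nat x) * (- 1) ^ x)) =
      (\<lambda>N. \<Sum>x<p ^ N. (\<Sum>a\<in>A. c a * f a (of_nat x)) * (- 1) ^ x)"
    unfolding sum_distrib_left sum_distrib_right by (subst sum.swap) (simp add: mult_ac)
  finally show "(\<lambda>N. \<Sum>x<p ^ N. (\<Sum>a\<in>A. c a * f a (of_nat x)) * (- 1) ^ x) \<longlonglongrightarrow>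
      (\<Sum>a\<in>A. c a * fermionic_integral p (f a))" .
qed

text \<open>The estimate holds for all Riemann sums, whose terms differ by at most \<open>e\<close>,
  and passes to the limit. It later yields uniform continuity of an inner integral in an outer
  variable.\<close>

lemma vabs_fermionic_integral_diff_le:
  fixes f g :: "'a::complete_ultrametric_field \<Rightarrow> 'a"
  assumes "padic_ucont p (\<lambda>n. f (of_nat n))" and "padic_ucont p (\<lambda>n. g (of_nat n))" and "odd p"
    and le: "\<And>n. vabs (f (of_nat n) - g (of_nat n)) \<le> e"
  shows "vabs (fermionic_integral p f - fermionic_integral p g) \<le> e"
proof (rule vabs_limit_le)
  show "(\<lambda>N. (\<Sum>x<p ^ N. f (of_nat x) * (- 1) ^ x) - (\<Sum>x<p ^ N. g (of_nat x) * (- 1) ^ x))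
      \<longlonglongrightarrow> fermionic_integral p f - fermionic_integral p g"
    by (intro tendsto_diff fermionic_integral_tendsto assms)
  have "e \<ge> 0" using le[of 0] vabs_nonneg order_trans by blast
  then show "vabs ((\<Sum>x<p ^ N. f (of_nat x) * (- 1) ^ x) - (\<Sum>x<p ^ N. g (of_nat x) * (- 1) ^ x)) \<le> e" for N
    unfolding sum_subtractf[symmetric] left_diff_distrib[symmetric]
    by (intro vabs_sum_le) (simp_all add: vabs_mult vabs_neg_one_power le)
qed

section \<open>Iterated integrals\<close>

text \<open>
  Boundedness has to be required here: points have infinitely many coordinates, so there are
  infinitely many residue classes modulo \<open>p\<^sup>N\<close>.
\<close>

definition padic_ucont_multi ::
  "nat \<Rightarrow> ((nat \<Rightarrow> 'a::complete_ultrametric_field) \<Rightarrow> 'a) \<Rightarrow> bool" where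
  "padic_ucont_multi p F \<longleftrightarrow>
     (\<exists>C. \<forall>m. vabs (F (\<lambda>i. of_nat (m i))) \<le> C) \<and>
     (\<forall>e>0. \<exists>N. \<forall>m m'. (\<forall>i. [m i = m' i] (mod p ^ N)) \<longrightarrow>
        vabs (F (\<lambda>i. of_nat (m i)) - F (\<lambda>i. of_nat (m' i))) \<le> e)"

lemma padic_ucont_multiE:
  assumes "padic_ucont_multi p F" and "e > 0"
  obtains N where "\<And>m m'. (\<And>i. [m i = m' i] (mod p ^ N)) \<Longrightarrow>
    vabs (F (\<lambda>i. of_nat (m i)) - F (\<lambda>i. of_nat (m' i))) \<le> e"
  using assms unfolding padic_ucont_multi_def by blast

lemma padic_ucont_multi_bounded:
  assumes "padic_ucont_multi p F"
  obtains C where "\<And>m. vabs (F (\<lambda>i. of_nat (m i))) \<le> C"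
  using assms unfolding padic_ucont_multi_def by blast

text \<open>\<open>\<phi>\<close> is the effect of a substitution on natural points. Fixing a
  coordinate and shifting affinely are both of this kind.\<close>

lemma padic_ucont_multi_reindex:
  fixes F :: "(nat \<Rightarrow> 'a::complete_ultrametric_field) \<Rightarrow> 'a"
  assumes F: "padic_ucont_multi p F"
    and eq: "\<And>m. G (\<lambda>i. of_nat (m i)) = F (\<lambda>i. of_nat (\<phi> m i))"
    and cong: "\<And>N m m' i. (\<And>i. [m i = m' i] (mod N)) \<Longrightarrow> [\<phi> m i = \<phi> m' i] (mod N)"
  shows "padic_ucont_multi p G"
  unfolding padic_ucont_multi_def
proof (intro conjI allI impI)
  show "\<exists>C. \<forall>m. vabs (G (\<lambda>i. of_nat (m i))) \<le> C"
    unfolding eq using padic_ucont_multi_bounded[OF F] by metis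
  fix e :: real assume "e > 0"
  from padic_ucont_multiE[OF F this] obtain N where
    N: "\<And>m m'. (\<And>i. [m i = m' i] (mod p ^ N)) \<Longrightarrow>
      vabs (F (\<lambda>i. of_nat (m i)) - F (\<lambda>i. of_nat (m' i))) \<le> e" by blast
  show "\<exists>N. \<forall>m m'. (\<forall>i. [m i = m' i] (mod p ^ N)) \<longrightarrow>
      vabs (G (\<lambda>i. of_nat (m i)) - G (\<lambda>i. of_nat (m' i))) \<le> e"
    unfolding eq by (intro exI[of _ N] allI impI N cong) blast
qed

lemma fun_upd_of_nat: "(\<lambda>i. of_nat (m i))(k := of_nat t) = (\<lambda>i. of_nat ((m(k := t)) i))"
  by auto

lemma padic_ucont_multi_fun_upd:
  "padic_ucont_multi p F \<Longrightarrow> padic_ucont_multi p (\<lambda>x. F (x(k := of_nat t)))"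
  by (erule padic_ucont_multi_reindex[where \<phi> = "\<lambda>m. m(k := t)"]) (simp_all only: fun_upd_of_nat, simp)

lemma padic_ucont_multi_mult:
  fixes F G :: "(nat \<Rightarrow> 'a::complete_ultrametric_field) \<Rightarrow> 'a"
  assumes F: "padic_ucont_multi p F" and G: "padic_ucont_multi p G"
  shows "padic_ucont_multi p (\<lambda>x. F x * G x)"
proof -
  obtain C1 where C1: "\<And>m. vabs (F (\<lambda>i. of_nat (m i))) \<le> C1"
    using padic_ucont_multi_bounded[OF F] by blast
  obtain C2 where C2: "\<And>m. vabs (G (\<lambda>i. of_nat (m i))) \<le> C2"
    using padic_ucont_multi_bounded[OF G] by blast
  \<comment> \<open>The 1 in the maximum makes the common bound positive, so that
    \<open>e / C\<close> is a valid tolerance.\<close>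
  define C where "C = max 1 (max C1 C2)"
  have C: "C \<ge> 1" "\<And>m. vabs (F (\<lambda>i. of_nat (m i))) \<le> C" "\<And>m. vabs (G (\<lambda>i. of_nat (m i))) \<le> C"
    using C1 C2 by (auto simp: C_def le_max_iff_disj)
  show ?thesis
    unfolding padic_ucont_multi_def
  proof (intro conjI allI impI)
    show "\<exists>C. \<forall>m. vabs (F (\<lambda>i. of_nat (m i)) * G (\<lambda>i. of_nat (m i))) \<le> C"
      using C by (intro exI[of _ "C * C"]) (auto simp: vabs_mult vabs_nonneg intro!: mult_mono)
    fix e :: real assume "e > 0"
    then have e: "e / C > 0" using C by simp
    obtain N1 where N1: "\<And>m m'. (\<And>i. [m i = m' i] (mod p ^ N1)) \<Longrightarrow>
        vabs (F (\<lambda>i. of_nat (m i)) - F (\<lambda>i. of_nat (m' i))) \<le> e / C"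
      using padic_ucont_multiE[OF F e] by blast
    obtain N2 where N2: "\<And>m m'. (\<And>i. [m i = m' i] (mod p ^ N2)) \<Longrightarrow>
        vabs (G (\<lambda>i. of_nat (m i)) - G (\<lambda>i. of_nat (m' i))) \<le> e / C"
      using padic_ucont_multiE[OF G e] by blast
    \<comment> \<open>The modulus with exponent \<open>N1 + N2\<close> is a common multiple of the
      moduli for \<open>F\<close> and \<open>G\<close>.\<close>
    have "vabs (F (\<lambda>i. of_nat (m i)) * G (\<lambda>i. of_nat (m i)) -
        F (\<lambda>i. of_nat (m' i)) * G (\<lambda>i. of_nat (m' i))) \<le> e"
      if m: "\<And>i. [m i = m' i] (mod p ^ (N1 + N2))" for m m'
    proof -
      let ?F = "F (\<lambda>i. of_nat (m i))" and ?F' = "F (\<lambda>i. of_nat (m' i))"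
      let ?G = "G (\<lambda>i. of_nat (m i))" and ?G' = "G (\<lambda>i. of_nat (m' i))"
      have *: "vabs (?F - ?F') \<le> e / C" "vabs (?G - ?G') \<le> e / C"
        by (rule N1 N2, rule cong_dvd_modulus_nat[OF m], simp add: power_add)+
      have "vabs ((?F - ?F') * ?G) \<le> e / C * C" "vabs ((?G - ?G') * ?F') \<le> e / C * C"
        unfolding vabs_mult by (intro mult_mono * C less_imp_le[OF e] vabs_nonneg)+
      moreover have "e / C * C = e" using C by simp
      moreover have "?F * ?G - ?F' * ?G' = (?F - ?F') * ?G + (?G - ?G') * ?F'"
        by (simp add: algebra_simps)
      ultimately show ?thesis
        using vabs_add_le_max[of "(?F - ?F') * ?G" "(?G - ?G') * ?F'"] by simp
    qed
    then show "\<exists>N. \<forall>m m'. (\<forall>i. [m i = m' i] (mod p ^ N)) \<longrightarrow>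
        vabs (F (\<lambda>i. of_nat (m i)) * G (\<lambda>i. of_nat (m i)) -
          F (\<lambda>i. of_nat (m' i)) * G (\<lambda>i. of_nat (m' i))) \<le> e" by blast
  qed
qed

lemma padic_ucont_multi_const: "padic_ucont_multi p (\<lambda>_. c)"
  unfolding padic_ucont_multi_def by (auto simp: vabs_zero)

lemma padic_ucont_multi_power:
  "padic_ucont_multi p F \<Longrightarrow> padic_ucont_multi p (\<lambda>x. F x ^ n)"
  by (induction n) (simp_all add: padic_ucont_multi_const padic_ucont_multi_mult)

text \<open>Modulo a suitable \<open>p ^ N\<close> the function varies by at most 1 within a residue
  class, and there are only finitely many classes.\<close>

lemma padic_ucont_bounded:
  fixes f :: "nat \<Rightarrow> 'a::complete_ultrametric_field"
  assumes "padic_ucont p f" and "p > 0"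
  obtains C where "\<And>n. vabs (f n) \<le> C"
proof -
  obtain N where N: "\<And>m m'. [m = m'] (mod p ^ N) \<Longrightarrow> vabs (f m - f m') \<le> 1"
    using assms(1) unfolding padic_ucont_def by (metis zero_less_one)
  define C where "C = 1 + (\<Sum>k<p ^ N. vabs (f k))"
  have "vabs (f n) \<le> C" for n
  proof -
    let ?k = "n mod p ^ N"
    have "vabs (f ?k) \<le> (\<Sum>k<p ^ N. vabs (f k))"
      using assms(2) by (intro member_le_sum) (auto simp: vabs_nonneg)
    moreover have "vabs (f n - f ?k) \<le> 1" by (rule N) (simp add: cong_def)
    ultimately show ?thesis
      using vabs_add_le_max[of "f n - f ?k" "f ?k"] vabs_nonneg[of "f ?k"] by (simp add: C_def)
  qed
  then show ?thesis by (rule that)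
qed

text \<open>A function of many variables that depends on them only through one natural number
  \<open>h m\<close> inherits both boundedness and uniform continuity from one variable.\<close>

lemma padic_ucont_multi_compose:
  fixes f :: "nat \<Rightarrow> 'a::complete_ultrametric_field"
  assumes f: "padic_ucont p f" and "p > 0"
    and eq: "\<And>m. F (\<lambda>i. of_nat (m i)) = f (h m)"
    and cong: "\<And>N m m'. (\<And>i. [m i = m' i] (mod N)) \<Longrightarrow> [h m = h m'] (mod N)"
  shows "padic_ucont_multi p F"
  unfolding padic_ucont_multi_def
proof (intro conjI allI impI)
  show "\<exists>C. \<forall>m. vabs (F (\<lambda>i. of_nat (m i))) \<le> C"
    unfolding eq using padic_ucont_bounded[OF f \<open>p > 0\<close>] by metis
  fix e :: real assume "e > 0"
  then obtain N where N: "\<And>m m'. [m = m'] (mod p ^ N) \<Longrightarrow> vabs (f m - f m') \<le> e"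
    using f unfolding padic_ucont_def by blast
  show "\<exists>N. \<forall>m m'. (\<forall>i. [m i = m' i] (mod p ^ N)) \<longrightarrow>
      vabs (F (\<lambda>i. of_nat (m i)) - F (\<lambda>i. of_nat (m' i))) \<le> e"
    unfolding eq by (intro exI[of _ N] allI impI N cong) blast
qed

section \<open>Congruence, continuity and linearity of iterated integrals\<close>

lemma iterated_fermionic_integral_cong:
  assumes "\<And>m. F (\<lambda>i. of_nat (m i)) = G (\<lambda>i. of_nat (m i))"
  shows "iterated_fermionic_integral p r F = iterated_fermionic_integral p r G"
  using assms
proof (induction r arbitrary: F G)
  case 0
  then show ?case using 0[of "\<lambda>_. 0"] by simp
next
  case (Suc r)
  show ?case
    unfolding iterated_fermionic_integral.simps
    by (intro fermionic_integral_cong Suc.IH) (simp only: fun_upd_of_nat Suc.prems)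
qed

lemma padic_ucont_inner_integral_aux:
  fixes F :: "(nat \<Rightarrow> 'a::complete_ultrametric_field) \<Rightarrow> 'a"
  assumes diff: "\<And>F G e. padic_ucont_multi p F \<Longrightarrow> padic_ucont_multi p G \<Longrightarrow>
      (\<And>m. vabs (F (\<lambda>i. of_nat (m i)) - G (\<lambda>i. of_nat (m i)) :: 'a) \<le> e) \<Longrightarrow>
      vabs (iterated_fermionic_integral p r F - iterated_fermionic_integral p r G) \<le> e"
    and F: "padic_ucont_multi p F"
  shows "padic_ucont p (\<lambda>t. iterated_fermionic_integral p r (\<lambda>x. F (x(k := of_nat t))))"
  unfolding padic_ucont_def
proof (intro allI impI)
  fix e :: real assume "e > 0"
  from padic_ucont_multiE[OF F this] obtain N where
    N: "\<And>m m'. (\<And>i. [m i = m' i] (mod p ^ N)) \<Longrightarrow>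
      vabs (F (\<lambda>i. of_nat (m i)) - F (\<lambda>i. of_nat (m' i))) \<le> e" by blast
  have "vabs (iterated_fermionic_integral p r (\<lambda>x. F (x(k := of_nat t))) -
      iterated_fermionic_integral p r (\<lambda>x. F (x(k := of_nat t')))) \<le> e"
    if "[t = t'] (mod p ^ N)" for t t'
  proof (intro diff padic_ucont_multi_fun_upd F)
    show "vabs (F ((\<lambda>i. of_nat (m i))(k := of_nat t)) - F ((\<lambda>i. of_nat (m i))(k := of_nat t'))) \<le> e" for m
      unfolding fun_upd_of_nat by (rule N) (use that in simp)
  qed
  then show "\<exists>N. \<forall>t t'. [t = t'] (mod p ^ N) \<longrightarrow>
      vabs (iterated_fermionic_integral p r (\<lambda>x. F (x(k := of_nat t))) -
        iterated_fermionic_integral p r (\<lambda>x. F (x(k := of_nat t')))) \<le> e" by blast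
qed

lemma vabs_iterated_fermionic_integral_diff_le:
  fixes F G :: "(nat \<Rightarrow> 'a::complete_ultrametric_field) \<Rightarrow> 'a"
  assumes "padic_ucont_multi p F" and "padic_ucont_multi p G" and "odd p"
    and "\<And>m. vabs (F (\<lambda>i. of_nat (m i)) - G (\<lambda>i. of_nat (m i))) \<le> e"
  shows "vabs (iterated_fermionic_integral p r F - iterated_fermionic_integral p r G) \<le> e"
  using assms(1,2,4)
proof (induction r arbitrary: F G e)
  case 0
  then show ?case using 0(3)[of "\<lambda>_. 0"] by simp
next
  case (Suc r)
  have ucont: "padic_ucont p (\<lambda>t. iterated_fermionic_integral p r (\<lambda>x. H (x(Suc r := of_nat t))))"
    if "padic_ucont_multi p H" for H :: "(nat \<Rightarrow> 'a) \<Rightarrow> 'a"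
    using Suc.IH that by (rule padic_ucont_inner_integral_aux)
  show ?case
    unfolding iterated_fermionic_integral.simps
  proof (rule vabs_fermionic_integral_diff_le[OF ucont ucont \<open>odd p\<close>])
    fix t
    show "vabs (iterated_fermionic_integral p r (\<lambda>x. F (x(Suc r := of_nat t))) -
        iterated_fermionic_integral p r (\<lambda>x. G (x(Suc r := of_nat t)))) \<le> e"
      by (intro Suc.IH padic_ucont_multi_fun_upd Suc.prems(1,2))
         (simp only: fun_upd_of_nat Suc.prems(3))
  qed (use Suc.prems in auto)
qed

lemma padic_ucont_inner_integral:
  fixes F :: "(nat \<Rightarrow> 'a::complete_ultrametric_field) \<Rightarrow> 'a"
  assumes "padic_ucont_multi p F" and "odd p"
  shows "padic_ucont p (\<lambda>t. iterated_fermionic_integral p r (\<lambda>x. F (x(k := of_nat t))))"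
  using assms by (intro padic_ucont_inner_integral_aux vabs_iterated_fermionic_integral_diff_le)

lemma iterated_fermionic_integral_scale:
  fixes F :: "(nat \<Rightarrow> 'a::complete_ultrametric_field) \<Rightarrow> 'a"
  assumes "padic_ucont_multi p F" and "odd p"
  shows "iterated_fermionic_integral p r (\<lambda>x. c * F x) = c * iterated_fermionic_integral p r F"
  using assms(1)
proof (induction r arbitrary: F)
  case (Suc r)
  have "iterated_fermionic_integral p (Suc r) (\<lambda>x. c * F x) =
      fermionic_integral p (\<lambda>t. \<Sum>a\<in>{()}. c * iterated_fermionic_integral p r (\<lambda>x. F (x(Suc r := t))))"
    unfolding iterated_fermionic_integral.simps
    by (rule fermionic_integral_cong) (simp add: Suc.IH padic_ucont_multi_fun_upd Suc.prems)
  also have "\<dots> = c * iterated_fermionic_integral p (Suc r) F"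
    by (subst fermionic_integral_linear)
       (simp_all add: padic_ucont_inner_integral Suc.prems \<open>odd p\<close>)
  finally show ?case .
qed simp

definition affine_shift :: "nat \<Rightarrow> nat \<Rightarrow> (nat \<Rightarrow> nat) \<Rightarrow> (nat \<Rightarrow> 'a::semiring_1) \<Rightarrow> nat \<Rightarrow> 'a" where
  "affine_shift d r a x = (\<lambda>i. if i \<in> {1..r} then of_nat (a i) + of_nat d * x i else x i)"

lemma affine_shift_of_nat:
  "affine_shift d r a (\<lambda>i. of_nat (m i)) = (\<lambda>i. of_nat (affine_shift d r a m i))"
  by (auto simp: affine_shift_def)

lemma affine_shift_Suc:
  "(affine_shift d r a x)(Suc r := of_nat b + of_nat d * t) =
     affine_shift d (Suc r) (a(Suc r := b)) (x(Suc r := t))"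
  by (auto simp: affine_shift_def fun_eq_iff)

lemma padic_ucont_multi_affine_shift:
  assumes "padic_ucont_multi p F"
  shows "padic_ucont_multi p (\<lambda>x. F (affine_shift d r a x))"
proof (rule padic_ucont_multi_reindex[OF assms, where \<phi> = "affine_shift d r a"])
  fix N :: nat and m m' :: "nat \<Rightarrow> nat" and i
  assume "\<And>i. [m i = m' i] (mod N)"
  then show "[affine_shift d r a m i = affine_shift d r a m' i] (mod N)"
    by (auto simp: affine_shift_def intro!: cong_add cong_mult)
qed (simp only: affine_shift_of_nat)

lemma iterated_fermionic_integral_distribution:
  fixes F :: "(nat \<Rightarrow> 'a::complete_ultrametric_field) \<Rightarrow> 'a"
  assumes "padic_ucont_multi p F" and p: "odd p" and d: "odd d"
  shows "iterated_fermionic_integral p r F =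
    (\<Sum>a \<in> {1..r} \<rightarrow>\<^sub>E {..<d}. (- 1) ^ (\<Sum>i=1..r. a i) *
       iterated_fermionic_integral p r (\<lambda>x. F (affine_shift d r a x)))"
  using assms(1)
proof (induction r arbitrary: F)
  case 0
  then show ?case by (simp add: affine_shift_def)
next
  case (Suc r)
  let ?P = "{1..r} \<rightarrow>\<^sub>E {..<d}"
  let ?G = "\<lambda>a x. F (affine_shift d (Suc r) a x)"
  let ?J = "\<lambda>F t. iterated_fermionic_integral p r (\<lambda>x. F (x(Suc r := t)))"
  have "?J F (of_nat b + of_nat d * of_nat t) =
      (\<Sum>a\<in>?P. (- 1) ^ (\<Sum>i=1..r. a i) * ?J (?G (a(Suc r := b))) (of_nat t))" for b t
    using Suc.IH[OF padic_ucont_multi_fun_upd[OF Suc.prems, of "Suc r" "b + d * t"]]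
    by (simp only: of_nat_add of_nat_mult affine_shift_Suc)
  then have step: "fermionic_integral p (\<lambda>t. ?J F (of_nat b + of_nat d * t)) =
      (\<Sum>a\<in>?P. (- 1) ^ (\<Sum>i=1..r. a i) * iterated_fermionic_integral p (Suc r) (?G (a(Suc r := b))))" for b
    unfolding iterated_fermionic_integral.simps
    by (subst fermionic_integral_linear[symmetric])
       (auto intro!: fermionic_integral_cong padic_ucont_inner_integral
          padic_ucont_multi_affine_shift Suc.prems p)
  have "iterated_fermionic_integral p (Suc r) F =
      (\<Sum>b<d. (- 1) ^ b * fermionic_integral p (\<lambda>t. ?J F (of_nat b + of_nat d * t)))"
    unfolding iterated_fermionic_integral.simps
    by (intro fermionic_integral_distribution padic_ucont_inner_integral Suc.prems p d)
  also have "\<dots> = (\<Sum>(b, a)\<in>{..<d} \<times> ?P. (- 1) ^ (\<Sum>i=1..Suc r. (a(Suc r := b)) i) *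
      iterated_fermionic_integral p (Suc r) (?G (a(Suc r := b))))"
    unfolding step
    by (simp add: sum.cartesian_product[symmetric] sum_distrib_left power_add mult_ac
        del: iterated_fermionic_integral.simps)
  also have "\<dots> = (\<Sum>a \<in> (\<lambda>(b, a). a(Suc r := b)) ` ({..<d} \<times> ?P). (- 1) ^ (\<Sum>i=1..Suc r. a i) *
      iterated_fermionic_integral p (Suc r) (?G a))"
    by (subst sum.reindex) (auto intro!: inj_combinator sum.cong simp del: iterated_fermionic_integral.simps)
  also have "(\<lambda>(b, a). a(Suc r := b)) ` ({..<d} \<times> ?P) = {1..Suc r} \<rightarrow>\<^sub>E {..<d}"
    using PiE_insert_eq[of "Suc r" "{1..r}" "\<lambda>_. {..<d}"] by (simp add: atLeastAtMostSuc_conv)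
  finally show ?case .
qed

section \<open>The integrand of the twisted Euler polynomials\<close>

lemma vabs_power_prime_power_minus_one_le:
  fixes q :: "'a::complete_ultrametric_field"
  assumes "vabs (1 - q) \<le> \<rho>" and "vabs (of_nat p :: 'a) \<le> \<rho>" and "\<rho> < 1"
  shows "vabs (1 - q ^ (p ^ N)) \<le> \<rho> ^ Suc N"
proof (induction N)
  case (Suc N)
  let ?Q = "q ^ (p ^ N)"
  have \<rho>: "\<rho> \<ge> 0" using assms(1) vabs_nonneg order_trans by blast
  have "\<rho> ^ Suc N \<le> \<rho>" using power_le_one[of \<rho> N] \<rho> assms(3) by (simp add: mult_left_le)
  then have Q: "vabs (1 - ?Q) \<le> \<rho>" using Suc by linarith
  have "vabs (?Q ^ i - 1) \<le> \<rho>" for i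
    using vabs_power_minus_one_le[of ?Q i] Q assms(3) by linarith
  then have "vabs (\<Sum>i<p. ?Q ^ i - 1) \<le> \<rho>"
    using \<rho> by (intro vabs_sum_le)
  moreover have "(\<Sum>i<p. ?Q ^ i) = (\<Sum>i<p. ?Q ^ i - 1) + of_nat p"
    by (simp add: sum_subtractf)
  ultimately have "vabs (\<Sum>i<p. ?Q ^ i) \<le> \<rho>"
    using vabs_add_le_max[of "\<Sum>i<p. ?Q ^ i - 1" "of_nat p"] assms(2) by simp
  then have "vabs (1 - ?Q) * vabs (\<Sum>i<p. ?Q ^ i) \<le> \<rho> ^ Suc N * \<rho>"
    using Suc \<rho> by (intro mult_mono) (auto simp: vabs_nonneg)
  moreover have "1 - q ^ (p ^ Suc N) = (1 - ?Q) * (\<Sum>i<p. ?Q ^ i)"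
    using one_diff_power_eq[of ?Q p] by (simp flip: power_mult add: mult.commute)
  ultimately show ?case by (simp add: vabs_mult mult.commute)
qed (use assms in simp)

lemma padic_ucontI:
  fixes f :: "nat \<Rightarrow> 'a::complete_ultrametric_field"
  assumes "0 \<le> \<rho>" "\<rho> < 1"
    and "\<And>m N k. vabs (f (m + p ^ N * k) - f m) \<le> C * \<rho> ^ N"
  shows "padic_ucont p f"
  unfolding padic_ucont_def
proof (intro allI impI)
  fix e :: real assume e: "e > 0"
  have "(\<lambda>N. C * \<rho> ^ N) \<longlonglongrightarrow> C * 0"
    using assms by (intro tendsto_mult tendsto_const LIMSEQ_power_zero) simp
  then have "eventually (\<lambda>N. C * \<rho> ^ N < e) sequentially"
    using e by (intro order_tendstoD(2)) auto
  then obtain N where N: "C * \<rho> ^ N < e" by (auto simp: eventually_sequentially)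
  have le: "vabs (f m - f m') \<le> e" if mm: "m' \<le> m" "[m = m'] (mod p ^ N)" for m m'
  proof -
    obtain k where "m = k * p ^ N + m'"
      using mm cong_le_nat[of m' m] by blast
    then show ?thesis using assms(3)[of m' N k] N by (simp add: ac_simps)
  qed
  have "vabs (f m - f m') \<le> e" if "[m = m'] (mod p ^ N)" for m m'
    using le[of m' m] le[of m m'] that vabs_uminus[of "f m - f m'"]
    by (cases "m' \<le> m") (auto dest: cong_sym)
  then show "\<exists>N. \<forall>m m'. [m = m'] (mod p ^ N) \<longrightarrow> vabs (f m - f m') \<le> e" by blast
qed

lemma padic_ucont_scaled_power:
  fixes q b c :: "'a::complete_ultrametric_field"
  assumes q: "vabs (1 - q) < 1" and p: "vabs (of_nat p :: 'a) < 1"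
  shows "padic_ucont p (\<lambda>n. b + c * q ^ n)"
proof -
  define \<rho> where "\<rho> = max (vabs (1 - q)) (vabs (of_nat p :: 'a))"
  have \<rho>: "0 \<le> \<rho>" "\<rho> < 1" "vabs (1 - q) \<le> \<rho>" "vabs (of_nat p :: 'a) \<le> \<rho>"
    using q p by (auto simp: \<rho>_def vabs_nonneg le_max_iff_disj)
  have q1: "vabs q \<le> 1"
    using vabs_diff_le_max[of 1 "1 - q"] q by (simp add: vabs_one)
  show ?thesis
  proof (rule padic_ucontI[OF \<rho>(1,2)])
    fix m N k
    let ?Q = "q ^ (p ^ N)"
    have Q: "vabs (1 - ?Q) \<le> \<rho> ^ Suc N"
      using \<rho> by (intro vabs_power_prime_power_minus_one_le)
    also have "\<dots> \<le> \<rho> ^ N" using \<rho> by (intro power_decreasing) auto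
    finally have QN: "vabs (1 - ?Q) \<le> \<rho> ^ N" .
    also have "\<dots> \<le> 1" using \<rho> by (intro power_le_one) auto
    finally have "vabs (?Q ^ k - 1) \<le> vabs (1 - ?Q)" by (rule vabs_power_minus_one_le)
    then have "vabs (q ^ m) * vabs (?Q ^ k - 1) \<le> 1 * \<rho> ^ N"
      using QN q1 by (intro mult_mono) (auto simp: vabs_power vabs_nonneg power_le_one)
    then have "vabs c * (vabs (q ^ m) * vabs (?Q ^ k - 1)) \<le> vabs c * \<rho> ^ N"
      by (intro mult_left_mono) (auto simp: vabs_nonneg)
    moreover have "(b + c * q ^ (m + p ^ N * k)) - (b + c * q ^ m) = c * (q ^ m * (?Q ^ k - 1))"
      by (simp add: power_add power_mult right_diff_distrib)
    ultimately show "vabs ((b + c * q ^ (m + p ^ N * k)) - (b + c * q ^ m)) \<le> vabs c * \<rho> ^ N"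
      by (simp only: vabs_mult)
  qed
qed

lemma padic_ucont_qnum:
  fixes q y :: "'a::complete_ultrametric_field"
  assumes q: "vabs (1 - q) < 1" and p: "vabs (of_nat p :: 'a) < 1" and y: "y \<in> Zp"
  shows "padic_ucont p (\<lambda>n. qnum q (y + of_nat n))"
proof (cases "q = 1")
  case True
  show ?thesis
  proof (rule padic_ucontI[OF vabs_nonneg p, of _ _ 1])
    fix m N k
    have "vabs (of_nat p ^ N * of_nat k :: 'a) \<le> vabs (of_nat p :: 'a) ^ N * 1"
      unfolding vabs_mult vabs_power
      by (intro mult_left_mono vabs_of_nat_le) (simp add: vabs_nonneg)
    then show "vabs (qnum q (y + of_nat (m + p ^ N * k)) - qnum q (y + of_nat m))
        \<le> 1 * vabs (of_nat p :: 'a) ^ N"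
      by (simp add: qnum_def True)
  qed
next
  case False
  have eq: "(\<lambda>n. qnum q (y + of_nat n)) =
      (\<lambda>n. 1 / (1 - q) + (- padic_pow q y / (1 - q)) * q ^ n)"
    using False by (simp add: qnum_def padic_pow_add_of_nat[OF q y] diff_divide_distrib)
  show ?thesis unfolding eq by (rule padic_ucont_scaled_power[OF q p])
qed

definition euler_integrand ::
  "nat \<Rightarrow> nat \<Rightarrow> 'a::complete_ultrametric_field \<Rightarrow> 'a \<Rightarrow> 'a \<Rightarrow> (nat \<Rightarrow> 'a) \<Rightarrow> 'a" where
  "euler_integrand r n w q y x =
     padic_pow w (\<Sum>i=1..r. x i) * qnum q (y + (\<Sum>i=1..r. x i)) ^ n *
     padic_pow q (\<Sum>i=1..r. of_nat (r - i) * x i)"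

lemma twisted_q_euler_eq:
  "twisted_q_euler p r n w q y = iterated_fermionic_integral p r (euler_integrand r n w q y)"
  by (simp add: twisted_q_euler_def euler_integrand_def[abs_def])

lemma euler_integrand_of_nat:
  "euler_integrand r n w q y (\<lambda>i. of_nat (m i)) =
     w ^ (\<Sum>i=1..r. m i) * qnum q (y + of_nat (\<Sum>i=1..r. m i)) ^ n * q ^ (\<Sum>i=1..r. (r - i) * m i)"
  unfolding euler_integrand_def
  by (simp only: of_nat_sum[symmetric] of_nat_mult[symmetric] padic_pow_of_nat)

lemma padic_ucont_multi_euler_integrand:
  fixes q w y :: "'a::complete_ultrametric_field"
  assumes "vabs (1 - q) < 1" and "vabs (1 - w) < 1" and p: "vabs (of_nat p :: 'a) < 1" "p > 0"
    and "y \<in> Zp"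
  shows "padic_ucont_multi p (euler_integrand r n w q y)"
proof -
  have pow: "padic_ucont p (\<lambda>n. u ^ n)" if "vabs (1 - u) < 1" for u :: 'a
    using padic_ucont_scaled_power[OF that p(1), of 0 1] by simp
  show ?thesis
    unfolding euler_integrand_def
  proof (intro padic_ucont_multi_mult padic_ucont_multi_power)
    show "padic_ucont_multi p (\<lambda>x. padic_pow w (\<Sum>i=1..r. x i))"
      by (rule padic_ucont_multi_compose[OF pow p(2), of w _ "\<lambda>m. \<Sum>i=1..r. m i"])
         (auto intro!: cong_sum simp: assms padic_pow_of_nat simp flip: of_nat_sum)
    show "padic_ucont_multi p (\<lambda>x. qnum q (y + (\<Sum>i=1..r. x i)))"
      by (rule padic_ucont_multi_compose[OF padic_ucont_qnum p(2), of q y _ "\<lambda>m. \<Sum>i=1..r. m i"])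
         (auto simp: assms simp flip: of_nat_sum intro!: cong_sum)
    show "padic_ucont_multi p (\<lambda>x. padic_pow q (\<Sum>i=1..r. of_nat (r - i) * x i))"
      by (rule padic_ucont_multi_compose[OF pow p(2), of q _ "\<lambda>m. \<Sum>i=1..r. (r - i) * m i"])
         (simp_all only: assms of_nat_sum[symmetric] of_nat_mult[symmetric] padic_pow_of_nat,
          auto intro!: cong_sum cong_mult)
  qed
qed

lemma euler_integrand_affine_shift:
  fixes q w x :: "'a::complete_ultrametric_field"
  assumes q: "vabs (1 - q) < 1" and d: "vabs (of_nat d :: 'a) = 1"
    and z: "(of_nat (\<Sum>i=1..r. a i) + x) / of_nat d \<in> Zp"
  shows "euler_integrand r n w q x (affine_shift d r a (\<lambda>i. of_nat (m i))) =
    qnum q (of_nat d) ^ n * q ^ (\<Sum>i=1..r. (r - i) * a i) * w ^ (\<Sum>i=1..r. a i) *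
    euler_integrand r n (w ^ d) (q ^ d) ((of_nat (\<Sum>i=1..r. a i) + x) / of_nat d) (\<lambda>i. of_nat (m i))"
proof -
  let ?A = "\<Sum>i=1..r. a i" and ?s = "\<Sum>i=1..r. m i" and ?b = "affine_shift d r a m"
  let ?z = "(of_nat ?A + x) / of_nat d"
  have d0: "of_nat d \<noteq> (0 :: 'a)" using d vabs_zero by (metis zero_neq_one)
  have sum: "(\<Sum>i=1..r. ?b i) = ?A + d * ?s"
    by (simp add: affine_shift_def sum.distrib sum_distrib_left)
  have wsum: "(\<Sum>i=1..r. (r - i) * ?b i) = (\<Sum>i=1..r. (r - i) * a i) + d * (\<Sum>i=1..r. (r - i) * m i)"
    by (simp add: affine_shift_def sum.distrib sum_distrib_left distrib_left mult.left_commute)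
  have "x + of_nat (?A + d * ?s) = of_nat d * (?z + of_nat ?s)"
    using d0 by (simp add: field_simps)
  moreover have "?z + of_nat ?s \<in> Zp"
    by (subst add.commute) (rule Zp_add_of_nat[OF z])
  ultimately have "qnum q (x + of_nat (?A + d * ?s)) = qnum q (of_nat d) * qnum (q ^ d) (?z + of_nat ?s)"
    using qnum_mult_of_nat[OF q d] by simp
  then show ?thesis
    unfolding affine_shift_of_nat euler_integrand_of_nat sum wsum
    by (simp add: power_add power_mult power_mult_distrib mult_ac)
qed

text \<open>If \<open>d > 1\<close>, then \<open>x / d\<close> and \<open>(1 + x) / d\<close> are both \<open>p\<close>-adic integers, hence so is \<open>1 / d\<close>.\<close>

lemma vabs_of_nat_eq_one:
  fixes r d :: nat and x :: "'a::complete_ultrametric_field"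
  assumes "r \<ge> 1" and "d \<ge> 1"
    and "\<forall>a \<in> {1..r} \<rightarrow>\<^sub>E {..<d}. (of_nat (\<Sum>i=1..r. a i) + x) / of_nat d \<in> Zp"
  shows "vabs (of_nat d :: 'a) = 1"
proof (cases "d = 1")
  case False
  have *: "vabs ((of_nat k + x) / of_nat d) \<le> 1" if "k < d" for k
  proof -
    define a where "a = (\<lambda>i\<in>{1..r}. if i = 1 then k else 0)"
    have "a \<in> {1..r} \<rightarrow>\<^sub>E {..<d}" using that by (auto simp: a_def)
    moreover have "(\<Sum>i=1..r. a i) = k" using assms(1) by (simp add: a_def)
    ultimately show ?thesis using assms(3) vabs_le_one_Zp by metis
  qed
  have d0: "of_nat d \<noteq> (0 :: 'a)" using assms(2) by simp
  have "vabs ((of_nat 1 + x) / of_nat d - (of_nat 0 + x) / of_nat d) \<le> 1"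
    using *[of 0] *[of 1] False assms(2) by (intro order_trans[OF vabs_diff_le_max] max.boundedI) auto
  then have "vabs (1 / of_nat d :: 'a) \<le> 1" by (simp flip: diff_divide_distrib)
  moreover have "vabs (1 / of_nat d :: 'a) * vabs (of_nat d :: 'a) = 1"
    using d0 by (simp flip: vabs_mult add: vabs_one)
  ultimately have "1 \<le> vabs (of_nat d :: 'a)"
    using mult_right_mono[of "vabs (1 / of_nat d :: 'a)" 1 "vabs (of_nat d :: 'a)"]
    by (simp add: vabs_nonneg)
  then show ?thesis by (intro antisym vabs_of_nat_le)
qed (simp add: vabs_one)

theorem theorem11:
  fixes p r n d :: nat and q w x :: "'a::complete_ultrametric_field"
  assumes "is_Cp p TYPE('a)" and "odd p"
    and "vabs (1 - q) < 1" and "vabs (1 - w) < 1"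
    and "r \<ge> 1" and "x \<in> Zp" and "odd d"
    and "\<forall>a \<in> {1..r} \<rightarrow>\<^sub>E {..<d}. (of_nat (\<Sum>i=1..r. a i) + x) / of_nat d \<in> Zp"
  shows "twisted_q_euler p r n w q x =
    qnum q (of_nat d) ^ n *
    (\<Sum>a \<in> {1..r} \<rightarrow>\<^sub>E {..<d}.
       q ^ (\<Sum>i=1..r. (r - i) * a i) * (- 1) ^ (\<Sum>i=1..r. a i) * w ^ (\<Sum>i=1..r. a i) *
       twisted_q_euler p r n (w ^ d) (q ^ d) ((of_nat (\<Sum>i=1..r. a i) + x) / of_nat d))"
proof -
  have "prime p" and "vabs (of_nat p :: 'a) = 1 / real p"
    using assms(1) by (auto simp: is_Cp_def)
  then have p: "vabs (of_nat p :: 'a) < 1" "p > 0"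
    using prime_gt_1_nat[of p] by auto
  have d: "vabs (of_nat d :: 'a) = 1"
    using vabs_of_nat_eq_one[OF assms(5) _ assms(8)] \<open>odd d\<close> by (auto elim: oddE)
  have pow: "vabs (1 - u ^ d) < 1" if "vabs (1 - u) < 1" for u :: 'a
    using vabs_power_minus_one_le[of u d] that by (simp add: vabs_one_minus_commute)
  let ?z = "\<lambda>a. (of_nat (\<Sum>i=1..r. a i) + x) / of_nat d"
  have "iterated_fermionic_integral p r (\<lambda>y. euler_integrand r n w q x (affine_shift d r a y)) =
      qnum q (of_nat d) ^ n * q ^ (\<Sum>i=1..r. (r - i) * a i) * w ^ (\<Sum>i=1..r. a i) *
      twisted_q_euler p r n (w ^ d) (q ^ d) (?z a)" if "a \<in> {1..r} \<rightarrow>\<^sub>E {..<d}" for a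
  proof -
    have z: "?z a \<in> Zp" using assms(8) that by blast
    show ?thesis
      unfolding twisted_q_euler_eq
      by (subst iterated_fermionic_integral_scale[symmetric])
         (intro padic_ucont_multi_euler_integrand iterated_fermionic_integral_cong
           euler_integrand_affine_shift pow assms(2-4) p d z)+
  qed
  then have "twisted_q_euler p r n w q x = (\<Sum>a \<in> {1..r} \<rightarrow>\<^sub>E {..<d}. (- 1) ^ (\<Sum>i=1..r. a i) *
      (qnum q (of_nat d) ^ n * q ^ (\<Sum>i=1..r. (r - i) * a i) * w ^ (\<Sum>i=1..r. a i) *
      twisted_q_euler p r n (w ^ d) (q ^ d) (?z a)))"
    unfolding twisted_q_euler_eq[of p r n w q x]
    by (subst iterated_fermionic_integral_distribution[OF _ \<open>odd p\<close> \<open>odd d\<close>])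
       (simp_all add: padic_ucont_multi_euler_integrand assms(3,4,6) p cong: sum.cong)
  then show ?thesis by (simp add: sum_distrib_left mult_ac)
qed

end
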